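(* Let $n\ge 1$ and let $w=u\,a\,v\,b\,Sym(u)\,b$ be an element of $F_n$, where $u\,a$ is the principal prefix of $w$. Then the following statements hold: (i) $\delta(u\,a)=M$, where $M$ is the maximal level of $w$, and $\delta(v)=0$; (ii) $u$ and $u\,a\,v$ are palindromes; (iii) if $v=\lambda$, then $w=a^n\,b^{n+1}$; (iv) if $v\neq\lambda$, then $v$ can be decomposed as $v=v_1\,a\,v_2$, with $v_1$ and $v_2$ palindromes and $v_2$ possibly empty; furthermore, $u=v_2\,(a\,v)^t$ for some integer $t\ge 0$.
   Context: Words are over $\{a,b\}$; $\lambda$ is the empty word; $x^k$ is the concatenation of $k$ copies of $x$. For a word $w=w_1\cdots w_m$: $\delta(w)=|w|_a-|w|_b$, where $|w|_a,|w|_b$ are the numbers of letters $a$ and $b$; the complement $\overline{w}$ exchanges $a$ and $b$ letterwise; the mirror is $\widetilde{w}=w_m\cdots w_1$; and $Sym(w)=\overline{w}_m\cdots\overline{w}_1$. A word is a palindrome if it equals its mirror. Two words are conjugate if they have the form $uv$ and $vu$. A Dyck word of length $2n$ is a word $w$ of length $2n$ with $\delta(w)=0$ and $\delta(v)\ge 0$ for each prefix $v$ of $w$. $D_n$ is the set of words $w\,b$ with $w$ a Dyck word of length $2n$. By the Cycle Lemma, every word with $n$ letters $a$ and $n+1$ letters $b$ has exactly one conjugate in $D_n$. The involution $\alpha:D_n\to D_n$ sends $w$ to the unique conjugate of $\widetilde{w}$ lying in $D_n$. The involution $\beta:D_n\to D_n$ sends $w_1\cdots w_{2n}\,b$ to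 $Sym(w_1\cdots w_{2n})\,b$. The permutation $\gamma$ of $D_n$ is $\gamma(w)=\alpha(\beta(w))$, and $F_n\subset D_n$ is the set of fixed points of $\gamma$ in $D_n$. Reading $a$ as the step $(1,1)$ and $b$ as the step $(1,-1)$, starting from the origin, a word is identified with a lattice path; the level of a point of the path is its ordinate, i.e. $\delta$ of the corresponding prefix, and the maximal level of $w$ is the maximum of $\delta(p)$ over all prefixes $p$ of $w$. The principal prefix of $w$ is the shortest prefix $p$ of $w$ such that $\delta(p)$ is maximal. *)

theory Defs
  imports Main "HOL-Library.Sublist"
begin

datatype letter = A | B

type_synonym word = "letter list"

definition delta :: "word \<Rightarrow> int" where
  "delta w = int (count_list w A) - int (count_list w B)"

fun compl_letter :: "letter \<Rightarrow> letter" where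
  "compl_letter A = B"
| "compl_letter B = A"

definition Sym :: "word \<Rightarrow> word" where
  "Sym w = rev (map compl_letter w)"

definition palindrome :: "word \<Rightarrow> bool" where
  "palindrome w \<longleftrightarrow> rev w = w"

definition conjugate :: "word \<Rightarrow> word \<Rightarrow> bool" where
  "conjugate x y \<longleftrightarrow> (\<exists>u v. x = u @ v \<and> y = v @ u)"

definition dyck_word :: "nat \<Rightarrow> word \<Rightarrow> bool" where
  "dyck_word n w \<longleftrightarrow> length w = 2 * n \<and> delta w = 0 \<and> (\<forall>v. prefix v w \<longrightarrow> 0 \<le> delta v)"

definition D :: "nat \<Rightarrow> word set" where
  "D n = {w @ [B] | w. dyck_word n w}"

text \<open>
  For \<open>w \<in> D n\<close> the mirror \<open>rev w\<close> has \<open>n\<close> letters \<open>a\<close> and \<open>n + 1\<close> letters \<open>b\<close>, so by the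
  Cycle Lemma the description below denotes a unique word; outside \<open>D n\<close> the value of
  \<open>alpha n\<close> is irrelevant.
\<close>

definition alpha :: "nat \<Rightarrow> word \<Rightarrow> word" where
  "alpha n w = (THE w'. w' \<in> D n \<and> conjugate (rev w) w')"

definition beta :: "word \<Rightarrow> word" where
  "beta w = Sym (butlast w) @ [B]"

definition gamma :: "nat \<Rightarrow> word \<Rightarrow> word" where
  "gamma n w = alpha n (beta w)"

definition F :: "nat \<Rightarrow> word set" where
  "F n = {w \<in> D n. gamma n w = w}"

definition max_level :: "word \<Rightarrow> int" where
  "max_level w = Max {delta p | p. prefix p w}"

definition principal_prefix :: "word \<Rightarrow> word" where
  "principal_prefix w = (ARG_MIN length p. prefix p w \<and> delta p = max_level w)"

end

theory Submission
  imports Defs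
begin

text \<open>
  Write \<open>c\<close> for the complement. For \<open>w = d b\<close> in \<open>D n\<close>, the mirror of \<open>beta w\<close> is \<open>b c(d)\<close>, whose
  first minimum is reached just after \<open>b c(u) b\<close>; rotating there gives
  \<open>c(v) a rev(u) b c(u) b\<close>, which is therefore \<open>gamma w\<close>. Comparing it with \<open>w\<close> shows that \<open>u\<close> is a
  palindrome and that \<open>c(v) a u = u a v\<close>. This word equation is solved by a Euclidean descent on
  the lengths of \<open>u\<close> and \<open>v\<close>.
\<close>

section \<open>Complementation and its effect on levels\<close>

abbreviation compl :: "word \<Rightarrow> word" where
  "compl \<equiv> map compl_letter"

lemma compl_letter_compl_letter [simp]: "compl_letter (compl_letter x) = x"
  by (cases x) auto

lemma compl_letter_neq [simp]: "compl_letter x \<noteq> x"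
  by (cases x) auto

lemma compl_letter_comp_compl_letter [simp]: "compl_letter \<circ> compl_letter = id"
  by auto

lemma inj_compl_letter: "inj compl_letter"
  by (metis compl_letter_compl_letter injI)

lemma compl_compl: "compl (compl w) = w"
  by simp

lemma compl_eq_self_iff: "compl w = w \<longleftrightarrow> w = []"
  by (cases w) auto

lemma delta_Nil [simp]: "delta [] = 0"
  by (simp add: delta_def)

lemma delta_append [simp]: "delta (x @ y) = delta x + delta y"
  by (simp add: delta_def)

lemma delta_Cons [simp]: "delta (x # w) = (if x = A then 1 else -1) + delta w"
  by (cases x) (auto simp: delta_def)

lemma delta_rev [simp]: "delta (rev w) = delta w"
  by (induction w) auto

lemma delta_compl [simp]: "delta (compl w) = - delta w"
proof (induction w)
  case (Cons x w)
  then show ?case by (cases x) auto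
qed auto

lemma delta_Sym [simp]: "delta (Sym w) = - delta w"
  by (simp add: Sym_def)

section \<open>Maximal level and principal prefix\<close>

lemma delta_le_max_level:
  assumes "prefix p w"
  shows "delta p \<le> max_level w"
proof -
  have "{delta p | p. prefix p w} = delta ` set (prefixes w)" by auto
  then show ?thesis using assms by (auto simp: max_level_def intro!: Max_ge)
qed

text \<open>A word has finitely many prefixes and at least one, so the maximum is attained and
  \<open>ARG_MIN\<close> chooses among a nonempty set of candidates.\<close>

lemma
  shows prefix_principal_prefix: "prefix (principal_prefix w) w"
    and delta_principal_prefix: "delta (principal_prefix w) = max_level w"
    and length_principal_prefix_le:
      "prefix p w \<Longrightarrow> delta p = max_level w \<Longrightarrow> length (principal_prefix w) \<le> length p"
proof -
  have eq: "{delta p | p. prefix p w} = delta ` set (prefixes w)" by auto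
  have "max_level w \<in> delta ` set (prefixes w)"
    unfolding max_level_def eq by (intro Max_in) auto
  then obtain p where p: "prefix p w \<and> delta p = max_level w" by auto
  note lem = arg_min_nat_lemma[where P = "\<lambda>p. prefix p w \<and> delta p = max_level w" and m = length,
      OF p, folded principal_prefix_def]
  show "prefix (principal_prefix w) w" "delta (principal_prefix w) = max_level w"
    using lem by auto
  show "length (principal_prefix w) \<le> length p"
    if "prefix p w" "delta p = max_level w" for p
    using lem that by auto
qed

text \<open>Equality would give a prefix of maximal level shorter than the shortest one.\<close>

lemma delta_less_max_level:
  assumes "strict_prefix p (principal_prefix w)"
  shows "delta p < max_level w"
proof -
  have "prefix p w"
    using assms prefix_principal_prefix[of w] by (meson prefix_order.less_imp_le prefix_order.trans)
  then show ?thesis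
    using delta_le_max_level[of p w] length_principal_prefix_le[of p w] prefix_length_less[OF assms]
    by fastforce
qed

section \<open>Conjugacy and uniqueness of representatives in \<open>D n\<close>\<close>

text \<open>Rotations compose, which makes transitivity of conjugacy immediate.\<close>

lemma conjugate_iff_rotate: "conjugate x y \<longleftrightarrow> (\<exists>k. y = rotate k x)"
proof
  assume "conjugate x y"
  then obtain p q where "x = p @ q" "y = q @ p" by (auto simp: conjugate_def)
  then have "y = rotate (length p) x" by (simp add: rotate_append)
  then show "\<exists>k. y = rotate k x" ..
next
  assume "\<exists>k. y = rotate k x"
  then show "conjugate x y"
    unfolding conjugate_def by (metis append_take_drop_id rotate_drop_take)
qed

lemma conjugate_sym: "conjugate x y \<Longrightarrow> conjugate y x"
  by (auto simp: conjugate_def)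

lemma conjugate_trans: "conjugate x y \<Longrightarrow> conjugate y z \<Longrightarrow> conjugate x z"
  by (auto simp: conjugate_iff_rotate rotate_rotate)

lemma delta_D: "w \<in> D n \<Longrightarrow> delta w = -1"
  by (auto simp: D_def dyck_word_def)

lemma length_D: "w \<in> D n \<Longrightarrow> length w = 2 * n + 1"
  by (auto simp: D_def dyck_word_def)

lemma delta_strict_prefix_D:
  assumes "p @ q \<in> D n" "q \<noteq> []"
  shows "0 \<le> delta p"
proof -
  obtain d where d: "p @ q = d @ [B]" "dyck_word n d" using assms(1) by (auto simp: D_def)
  then have "prefix p d"
    using assms(2) by (metis append_butlast_last_id append_eq_append_conv2 butlast_append
        butlast_snoc prefixI)
  then show ?thesis using d(2) by (auto simp: dyck_word_def)
qed

text \<open>This is the uniqueness half of the Cycle Lemma: if \<open>p\<close> and \<open>q\<close>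
  are both nonempty, each is a proper prefix of a word in \<open>D n\<close> and has level at least
  0, whereas their levels add up to -1.\<close>

lemma conjugate_D_unique:
  assumes "x \<in> D n" "y \<in> D n" "conjugate x y"
  shows "x = y"
proof -
  obtain p q where pq: "x = p @ q" "y = q @ p" using assms(3) by (auto simp: conjugate_def)
  show ?thesis
  proof (rule ccontr)
    assume "x \<noteq> y"
    then have "p \<noteq> []" "q \<noteq> []" using pq by auto
    then have "0 \<le> delta p" "0 \<le> delta q"
      using delta_strict_prefix_D assms(1,2) pq by blast+
    then show False using delta_D[OF assms(1)] pq by simp
  qed
qed

lemma alpha_eqI:
  assumes "w' \<in> D n" "conjugate (rev w) w'"
  shows "alpha n w = w'"
  unfolding alpha_def
proof (rule the_equality)
  show "w' \<in> D n \<and> conjugate (rev w) w'" using assms by simp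
next
  fix x assume "x \<in> D n \<and> conjugate (rev w) x"
  then show "x = w'" using assms conjugate_D_unique conjugate_sym conjugate_trans by blast
qed

section \<open>Computation of \<open>gamma\<close>\<close>

lemma gamma_eq:
  assumes wD: "w \<in> D n"
    and w: "w = u @ [A] @ v @ [B] @ Sym u @ [B]"
    and pp: "principal_prefix w = u @ [A]"
  shows "gamma n w = compl v @ [A] @ rev u @ [B] @ compl u @ [B]"
proof -
  have M: "max_level w = delta u + 1"
    using delta_principal_prefix[of w] pp by simp
  have dv: "delta v = 0" using delta_D[OF wD] w by simp
  have le: "delta p \<le> delta u + 1" if "prefix p w" for p
    using delta_le_max_level[OF that] M by simp
  \<comment> \<open>Prefixes of \<open>u\<close>, including \<open>u\<close> itself, end before the
    first maximum, so the bound improves by one.\<close>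
  have less: "delta p \<le> delta u" if "prefix p u" for p
  proof -
    have "strict_prefix p (principal_prefix w)"
      using that pp by (auto simp: strict_prefix_def dest: prefix_length_le)
    then show ?thesis using delta_less_max_level[of p w] M by simp
  qed
  let ?d = "compl v @ [A] @ rev u @ [B] @ compl u"
  have "dyck_word n ?d"
    unfolding dyck_word_def
  proof (intro conjI allI impI)
    show "length ?d = 2 * n" using length_D[OF wD] w by (simp add: Sym_def)
    show "delta ?d = 0" using dv by simp
  next
    fix p assume "prefix p ?d"
    then consider
        "prefix p (compl v)"
      | r where "p = compl v @ [A] @ r" "prefix r (rev u)"
      | r where "p = compl v @ [A] @ rev u @ [B] @ r" "prefix r (compl u)"
      by (auto simp: prefix_append prefix_Cons)
    then show "0 \<le> delta p"
    proof cases
      case 1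
      then have "prefix (compl p) v"
        by (metis compl_compl map_mono_prefix)
      \<comment> \<open>This prefix of \<open>w\<close> has level
        \<open>delta u + 1 - delta p\<close>, which may not exceed the maximum
        \<open>delta u + 1\<close>.\<close>
      then have "prefix (u @ [A] @ compl p) w" using w by (auto simp: prefix_def)
      from le[OF this] show ?thesis by simp
    next
      case (2 r)
      then obtain s where "rev u = r @ s" by (auto simp: prefix_def)
      then have u: "u = rev s @ rev r" by (metis rev_append rev_rev_ident)
      then have "prefix (rev s) w" using w by (auto simp: prefix_def)
      \<comment> \<open>Here \<open>delta p = 1 + delta r\<close>, and
        \<open>delta r = delta u - delta (rev s)\<close>.\<close>
      from le[OF this] show ?thesis using 2 dv u
        using less[of "rev s"] by simp
    next
      case (3 r)
      then have "prefix (compl r) u"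
        by (metis compl_compl map_mono_prefix)
      \<comment> \<open>Now \<open>delta p = delta u - delta (compl r)\<close>: the letter
        \<open>B\<close> has used up the spare unit, so the sharper bound is required.\<close>
      from less[OF this] show ?thesis using 3 dv by simp
    qed
  qed
  then have "?d @ [B] \<in> D n" unfolding D_def by blast
  moreover have "rev (beta w) = ([B] @ compl u @ [B]) @ (compl v @ [A] @ rev u)"
    by (simp add: w beta_def Sym_def butlast_append rev_map)
  then have "conjugate (rev (beta w)) (?d @ [B])"
    unfolding conjugate_def by (metis append.assoc)
  ultimately show ?thesis
    using alpha_eqI unfolding gamma_def by fastforce
qed

section \<open>The word equation\<close>

text \<open>A form of Levi's lemma: the shorter head together with its marked letter is a prefix of
  the longer head.\<close>

lemma append_Cons_eq_append_Cons:
  assumes "x @ a # y = z @ b # w" "length x < length z"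
  obtains s where "z = x @ a # s" "y = s @ b # w"
proof -
  obtain us where "z = x @ us" "us @ b # w = a # y"
    using assms by (auto simp: append_eq_append_conv2)
  then show thesis using assms(2) that by (cases us) auto
qed

text \<open>If \<open>u\<close> is longer than \<open>v\<close>, a factor \<open>a v\<close> is
  split off from \<open>u\<close>; if \<open>v\<close> is longer, \<open>u\<close> becomes the
  suffix \<open>p\<close> of \<open>v\<close> and the descent ends up to showing that
  \<open>r\<close> is a palindrome. The conclusion \<open>rev v = compl v\<close> is carried along
  because that last point uses it for a shorter word.\<close>

lemma compl_word_equation:
  assumes "compl v @ [A] @ u = u @ [A] @ v" "palindrome u"
  shows "rev v = compl v \<and>
    (v \<noteq> [] \<longrightarrow> (\<exists>r p t. v = r @ [A] @ p \<and> palindrome r \<and> palindrome p \<and>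
      u = p @ concat (replicate t ([A] @ v))))"
  using assms
proof (induction "length u + length v" arbitrary: u v rule: less_induct)
  case less
  have eq: "compl v @ A # u = u @ A # v" and pal: "rev u = u"
    using less.prems by (auto simp: palindrome_def)
  consider "length v < length u" | "length v = length u" | "length u < length v"
    by linarith
  then show ?case
  proof cases
    case 1
    then obtain u' where u': "u = compl v @ A # u'" and u'': "u = u' @ A # v"
      using append_Cons_eq_append_Cons[OF eq] by auto
    \<comment> \<open>The mirror of \<open>compl v a u'\<close> equals \<open>u' a v\<close>, since
      both are \<open>u\<close>; the heads have equal length.\<close>
    have "rev u' @ A # rev (compl v) = u' @ A # v"
      using pal u' u'' by (metis append.assoc append_Cons append_Nil rev.simps(2) rev_append)
    then have "palindrome u'" by (simp add: palindrome_def)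
    moreover have "compl v @ [A] @ u' = u' @ [A] @ v" using u' u'' by simp
    ultimately have IH: "rev v = compl v \<and>
      (v \<noteq> [] \<longrightarrow> (\<exists>r p t. v = r @ [A] @ p \<and> palindrome r \<and> palindrome p \<and>
        u' = p @ concat (replicate t ([A] @ v))))"
      using less.hyps[of u' v] u' by simp
    have step: "u = p @ concat (replicate (Suc t) ([A] @ v))"
      if "u' = p @ concat (replicate t ([A] @ v))" for p t
      unfolding u'' that replicate_Suc[of t] replicate_append_same[symmetric] by simp
    show ?thesis using IH step by blast
  next
    case 2
    then have "compl v = u" "u = v" using eq by auto
    then have "v = []" by (simp add: compl_eq_self_iff)
    then show ?thesis by simp
  next
    case 3
    then obtain r where cv: "compl v = u @ A # r" and v: "v = r @ A # u"
      using append_Cons_eq_append_Cons[OF eq[symmetric]] by auto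
    \<comment> \<open>Two expressions for \<open>compl v\<close>. The marked letters differ, which
      excludes \<open>u\<close> and \<open>r\<close> of equal length.\<close>
    have key: "u @ A # r = compl r @ B # compl u" using cv v by simp
    have "rev r = r"
    proof -
      consider "length u < length r" | "length u = length r" | "length r < length u"
        by linarith
      then show ?thesis
      proof cases
        case 1
        then obtain s where s: "compl r = u @ A # s" and r: "r = s @ B # compl u"
          using append_Cons_eq_append_Cons[OF key] by auto
        \<comment> \<open>Both sides are \<open>compl r\<close>, so the pair \<open>u\<close>,
          \<open>s\<close> satisfies the original equation with \<open>s\<close> shorter than
          \<open>v\<close>.\<close>
        have "compl s @ [A] @ u = u @ [A] @ s"
          using arg_cong[OF r, of compl] s by simp
        then have "rev s = compl s"
          using less.hyps[of u s] less.prems(2) v r by simp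
        moreover have "r = compl u @ B # compl s" using s by (metis compl_compl map_append list.map(2) compl_letter.simps(1))
        ultimately show ?thesis using r pal by (simp add: rev_map)
      next
        case 2
        then have False using key by simp
        then show ?thesis ..
      next
        case 3
        then obtain s where s: "u = compl r @ B # s" "compl u = s @ A # r"
          using append_Cons_eq_append_Cons[OF key[symmetric]] by auto
        \<comment> \<open>The mirror of this factorization of \<open>u\<close> begins with
          \<open>rev (compl r)\<close>, while \<open>u\<close> begins with
          \<open>compl r\<close>.\<close>
        then have "u = compl s @ B # compl r"
          by (metis compl_compl map_append list.map(2) compl_letter.simps(1))
        then have "rev u = rev (compl r) @ B # rev (compl s)" by simp
        then have "rev (compl r) = compl r" using s(1) pal by simp
        then have "compl (rev r) = compl r" by (simp add: rev_map)
        then show ?thesis using inj_map_eq_map[OF inj_compl_letter] by blast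
      qed
    qed
    then have "rev v = compl v" "palindrome r" using cv v pal by (auto simp: palindrome_def)
    \<comment> \<open>Base of the descent: \<open>p = u\<close> with exponent 0.\<close>
    moreover have "u = u @ concat (replicate 0 ([A] @ v))" by simp
    moreover have "v = r @ [A] @ u" using v by simp
    ultimately show ?thesis using less.prems(2) by blast
  qed
qed

section \<open>Structure of the fixed points of \<open>gamma\<close>\<close>

lemma Cons_eq_snoc_imp_replicate: "x # w = w @ [x] \<Longrightarrow> w = replicate (length w) x"
  by (induction w) auto

theorem proposition2:
  fixes n :: nat and w u v :: word
  assumes "n \<ge> 1"
    and "w \<in> F n"
    and "w = u @ [A] @ v @ [B] @ Sym u @ [B]"
    and "principal_prefix w = u @ [A]"
  shows "(delta (u @ [A]) = max_level w \<and> delta v = 0) \<and>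
    (palindrome u \<and> palindrome (u @ [A] @ v)) \<and>
    (v = [] \<longrightarrow> w = replicate n A @ replicate (n + 1) B) \<and>
    (v \<noteq> [] \<longrightarrow>
      (\<exists>v1 v2. v = v1 @ [A] @ v2 \<and> v1 \<noteq> [] \<and> palindrome v1 \<and> palindrome v2 \<and>
        (\<exists>t::nat. u = v2 @ concat (replicate t ([A] @ v)))))"
proof -
  have wD: "w \<in> D n" and fixed: "gamma n w = w" using assms(2) by (auto simp: F_def)
  have M: "delta (u @ [A]) = max_level w"
    using delta_principal_prefix[of w] assms(4) by simp
  have dv: "delta v = 0" using delta_D[OF wD] assms(3) by simp
  have "(u @ [A] @ v) @ [B] @ Sym u @ [B] = (compl v @ [A] @ rev u) @ [B] @ compl u @ [B]"
    using gamma_eq[OF wD assms(3,4)] fixed assms(3) by simp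
  \<comment> \<open>The parts before the second-to-last block have equal length, so the equality
    \<open>w = gamma n w\<close> splits there.\<close>
  then have "u @ [A] @ v = compl v @ [A] @ rev u \<and> Sym u = compl u"
    by (subst (asm) append_eq_append_conv) auto
  then have eq: "u @ [A] @ v = compl v @ [A] @ rev u" and "compl (rev u) = compl u"
    by (auto simp: Sym_def rev_map)
  then have u: "rev u = u" using inj_map_eq_map[OF inj_compl_letter] by blast
  then have pal: "palindrome u" by (simp add: palindrome_def)
  have eq': "compl v @ [A] @ u = u @ [A] @ v" using eq u by simp
  note sol = compl_word_equation[OF eq' pal]
  have pal': "palindrome (u @ [A] @ v)"
  proof -
    have "rev (u @ [A] @ v) = compl v @ [A] @ u" using conjunct1[OF sol] u by simp
    then show ?thesis using eq' by (simp add: palindrome_def)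
  qed
  have power: "w = replicate n A @ replicate (n + 1) B" if "v = []"
  proof -
    \<comment> \<open>With \<open>v\<close> empty the word equation says that \<open>u\<close>
      commutes with the letter \<open>A\<close>.\<close>
    have "A # u = u @ [A]" using eq' that by simp
    then have k: "u = replicate (length u) A" by (rule Cons_eq_snoc_imp_replicate)
    have "n = Suc (length u)" using length_D[OF wD] assms(3) that by (simp add: Sym_def)
    moreover have "Sym u = replicate (length u) B" by (subst k) (simp add: Sym_def)
    moreover have "u @ [A] = replicate (Suc (length u)) A"
      by (subst k) (simp add: replicate_append_same)
    ultimately show ?thesis using assms(3) that by (simp add: replicate_append_same)
  qed
  have decomp: "\<exists>v1 v2. v = v1 @ [A] @ v2 \<and> v1 \<noteq> [] \<and> palindrome v1 \<and> palindrome v2 \<and>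
      (\<exists>t::nat. u = v2 @ concat (replicate t ([A] @ v)))" if nonempty: "v \<noteq> []"
  proof -
    obtain r p t where rp: "v = r @ [A] @ p" "palindrome r" "palindrome p"
        "u = p @ concat (replicate t ([A] @ v))"
      using sol[THEN conjunct2, rule_format, OF nonempty] by (elim exE conjE)
    \<comment> \<open>Otherwise \<open>v\<close> would start with \<open>A\<close>, and the path
      would rise above its maximal level right after the principal prefix.\<close>
    have "r \<noteq> []"
    proof
      assume "r = []"
      then have "w = (u @ [A, A]) @ p @ [B] @ Sym u @ [B]" using rp(1) assms(3) by simp
      then have "prefix (u @ [A, A]) w" by (rule prefixI)
      from delta_le_max_level[OF this] show False using M by simp
    qed
    then show ?thesis
      using rp by (intro exI[of _ r] exI[of _ p] exI[of _ t] conjI)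
  qed
  show ?thesis
    by (intro conjI impI) (fact M dv pal pal' | erule power decomp)+
qed

end
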